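(* Let \[ \boldsymbol{T}=\begin{bmatrix} t_{1,1} & t_{1,2} \\ 0 & t_{2,2}\end{bmatrix}\in\mathbb{H}^{2\times 2}, \] where $t_{1,1}, t_{2,2}\in\mathbb{C}_+$ (and $t_{1,2}\in\mathbb{H}$ is an arbitrary quaternion). Then there exists a unitary matrix $\boldsymbol{Q}\in\mathbb{H}^{2\times 2}$ such that \[ \boldsymbol{Q}^{\mathsf{H}}\boldsymbol{T}\boldsymbol{Q}=\begin{bmatrix} t_{2,2} & t_{1,2} \\ 0 & t_{1,1}\end{bmatrix}. \]
   Context: $\mathbb{H}=\operatorname{span}_{\mathbb{R}}\{1,\mathrm{i},\mathrm{j},\mathrm{k}\}$ denotes the skew field of quaternions, with $\mathrm{i}^2=\mathrm{j}^2=\mathrm{k}^2=\mathrm{i}\mathrm{j}\mathrm{k}=-1$. The complex numbers are identified with the subfield $\mathbb{C}=\operatorname{span}_{\mathbb{R}}\{1,\mathrm{i}\}\subset\mathbb{H}$, and $\mathbb{C}_+=\{a+b\,\mathrm{i}: a,b\in\mathbb{R},\ b\ge 0\}$ is the closed upper half-plane (including the real axis). For a quaternion matrix $\boldsymbol{Q}$, $\boldsymbol{Q}^{\mathsf{H}}$ denotes its conjugate transpose with respect to quaternion conjugation $\overline{a+b\,\mathrm{i}+c\,\mathrm{j}+d\,\mathrm{k}}=a-b\,\mathrm{i}-c\,\mathrm{j}-d\,\mathrm{k}$. A square quaternion matrix $\boldsymbol{Q}$ is unitary if $\boldsymbol{Q}^{\mathsf{H}}\boldsymbol{Q}=\boldsymbol{I}$.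 *)

theory Defs
  imports "HOL-Analysis.Analysis"
begin

section \<open>The skew field of quaternions\<close>

datatype quat = Quat (qa: real) (qb: real) (qc: real) (qd: real)

lemma quat_eq_iff:
  "x = y \<longleftrightarrow> qa x = qa y \<and> qb x = qb y \<and> qc x = qc y \<and> qd x = qd y"
  by (cases x; cases y) simp

instantiation quat :: ab_group_add
begin

definition "0 = Quat 0 0 0 0"
definition "x + y = Quat (qa x + qa y) (qb x + qb y) (qc x + qc y) (qd x + qd y)"
definition "x - y = Quat (qa x - qa y) (qb x - qb y) (qc x - qc y) (qd x - qd y)"
definition "- x = Quat (- qa x) (- qb x) (- qc x) (- qd x)"

instance
  by standard
    (simp_all add: quat_eq_iff zero_quat_def plus_quat_def minus_quat_def uminus_quat_def)

end

instantiation quat :: real_div_algebra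
begin

definition "1 = Quat 1 0 0 0"

definition "x * y = Quat
  (qa x * qa y - qb x * qb y - qc x * qc y - qd x * qd y)
  (qa x * qb y + qb x * qa y + qc x * qd y - qd x * qc y)
  (qa x * qc y - qb x * qd y + qc x * qa y + qd x * qb y)
  (qa x * qd y + qb x * qc y - qc x * qb y + qd x * qa y)"

definition "scaleR r x = Quat (r * qa x) (r * qb x) (r * qc x) (r * qd x)"

text \<open>The inverse of a nonzero quaternion is its conjugate divided by its squared modulus.\<close>

definition "inverse x =
  (let n = (qa x)\<^sup>2 + (qb x)\<^sup>2 + (qc x)\<^sup>2 + (qd x)\<^sup>2
   in Quat (qa x / n) (- qb x / n) (- qc x / n) (- qd x / n))"

definition "x div (y::quat) = x * inverse y"

instance
proof
  fix x :: quat
  assume "x \<noteq> 0"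
  define n where "n = (qa x)\<^sup>2 + (qb x)\<^sup>2 + (qc x)\<^sup>2 + (qd x)\<^sup>2"
  have "n \<noteq> 0"
    using \<open>x \<noteq> 0\<close> unfolding n_def
    by (simp add: quat_eq_iff zero_quat_def add_nonneg_eq_0_iff)
  have inv: "inverse x = Quat (qa x / n) (- qb x / n) (- qc x / n) (- qd x / n)"
    by (simp add: inverse_quat_def n_def Let_def)
  have n: "(qa x * qa x + qb x * qb x + qc x * qc x + qd x * qd x) / n = 1"
    using \<open>n \<noteq> 0\<close> by (simp add: n_def power2_eq_square)
  show "inverse x * x = 1" and "x * inverse x = 1"
    using n by (simp_all add: inv quat_eq_iff times_quat_def one_quat_def
        add_divide_distrib mult.commute)
qed (simp_all add: quat_eq_iff zero_quat_def plus_quat_def one_quat_def times_quat_def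
    scaleR_quat_def divide_quat_def inverse_quat_def algebra_simps)

end

definition quat_i :: quat where "quat_i = Quat 0 1 0 0"
definition quat_j :: quat where "quat_j = Quat 0 0 1 0"
definition quat_k :: quat where "quat_k = Quat 0 0 0 1"

lemma quat_units_mult:
  "quat_i * quat_i = - 1" "quat_j * quat_j = - 1" "quat_k * quat_k = - 1"
  "quat_i * quat_j * quat_k = - 1"
  by (simp_all add: quat_i_def quat_j_def quat_k_def times_quat_def one_quat_def uminus_quat_def)

lemma Quat_eq:
  "Quat a b c d = of_real a + of_real b * quat_i + of_real c * quat_j + of_real d * quat_k"
  by (simp add: quat_i_def quat_j_def quat_k_def plus_quat_def times_quat_def one_quat_def
      scaleR_quat_def of_real_def)

definition quat_cnj :: "quat \<Rightarrow> quat" where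
  "quat_cnj x = Quat (qa x) (- qb x) (- qc x) (- qd x)"

text \<open>The closed upper half-plane of the copy of the complex numbers spanned by \<open>1\<close> and \<open>quat_i\<close>.\<close>

definition complex_upper :: "quat set" where
  "complex_upper = {of_real a + of_real b * quat_i | a b. b \<ge> 0}"


section \<open>Quaternion matrices\<close>

definition conj_transpose :: "quat ^ 'n ^ 'm \<Rightarrow> quat ^ 'm ^ 'n" where
  "conj_transpose Q = (\<chi> i j. quat_cnj (Q $ j $ i))"

definition unitary_quat :: "quat ^ 'n ^ 'n \<Rightarrow> bool" where
  "unitary_quat Q \<longleftrightarrow> conj_transpose Q ** Q = mat 1"

end

theory Submission
  imports Defs
begin

text \<open>
  Write \<open>a\<close>, \<open>b\<close>, \<open>c\<close> for \<open>t11\<close>, \<open>t22\<close>, \<open>t12\<close>. If \<open>a = b\<close>, the identity matrix does the job.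
  Otherwise split quaternions as \<open>z + w j\<close> with complex \<open>z\<close>, \<open>w\<close>. As \<open>j\<close> conjugates the complex
  numbers it passes, the Sylvester map \<open>x \<mapsto> x b - a x\<close> acts diagonally:
  it multiplies \<open>z\<close> by \<open>b - a\<close> and \<open>w\<close> by \<open>cnj b - a\<close>. Both factors are nonzero, because two
  distinct points of the closed upper half-plane are not conjugate to each other. Hence
  \<open>c = x b - a x\<close> has a solution \<open>x\<close> (\<open>sylvester_solution\<close>).

  This means that \<open>(x, 1)\<close> is a right eigenvector of \<open>T\<close> with eigenvalue \<open>b\<close>, and
  \<open>(1, - cnj x)\<close> is orthogonal to it. Normalised, these two columns form a unitary matrix that turns
  \<open>T\<close> into an upper triangular matrix with diagonal \<open>b, a\<close> and corner \<open>cnj x a - b cnj x\<close>.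
  The columns may still be multiplied from the right by complex units \<open>u\<close>, \<open>v\<close>, which commute with
  \<open>b\<close> and \<open>a\<close>, so the diagonal stays; the corner becomes \<open>c\<close> precisely when
  \<open>u c = (cnj x a - b cnj x) v\<close> (\<open>swap_by_rotated_eigenvector\<close>).

  In complex coordinates that equation asks for \<open>cnj u * v\<close> and \<open>cnj u * cnj v\<close> to be two prescribed
  complex numbers of modulus one: corresponding coordinates of \<open>c\<close> and of the corner have equal
  modulus. A square root of the product of those two numbers provides \<open>u\<close> and \<open>v\<close>
  (\<open>phases_with_given_products\<close>).
\<close>

section \<open>Quaternion conjugation\<close>

lemma quat_cnj_mult: "quat_cnj (x * y) = quat_cnj y * quat_cnj x"
  by (simp add: quat_cnj_def times_quat_def quat_eq_iff algebra_simps)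

lemma quat_cnj_cnj [simp]: "quat_cnj (quat_cnj x) = x"
  by (simp add: quat_cnj_def quat_eq_iff)

lemma quat_cnj_minus: "quat_cnj (- x) = - quat_cnj x"
  by (simp add: quat_cnj_def uminus_quat_def quat_eq_iff)

lemma quat_cnj_scaleR: "quat_cnj (r *\<^sub>R x) = r *\<^sub>R quat_cnj x"
  by (simp add: quat_cnj_def scaleR_quat_def quat_eq_iff)

lemma quat_cnj_0 [simp]: "quat_cnj 0 = 0"
  by (simp add: quat_cnj_def zero_quat_def)

lemma quat_cnj_1 [simp]: "quat_cnj 1 = 1"
  by (simp add: quat_cnj_def one_quat_def)

lemma quat_cnj_mult_self:
  obtains N where "N \<ge> 0" "x * quat_cnj x = of_real N" "quat_cnj x * x = of_real N"
proof
  let ?N = "(qa x)\<^sup>2 + (qb x)\<^sup>2 + (qc x)\<^sup>2 + (qd x)\<^sup>2"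
  show "?N \<ge> 0"
    by simp
  show "x * quat_cnj x = of_real ?N" "quat_cnj x * x = of_real ?N"
    by (simp_all add: of_real_def quat_cnj_def times_quat_def scaleR_quat_def one_quat_def
        power2_eq_square algebra_simps)
qed

section \<open>Quaternions as pairs of complex numbers\<close>

text \<open>\<open>quat_pair z w\<close> is the quaternion \<open>z + w j\<close>.\<close>

definition quat_pair :: "complex \<Rightarrow> complex \<Rightarrow> quat" where
  "quat_pair z w = Quat (Re z) (Im z) (Re w) (Im w)"

lemma quat_pair_cases: obtains z w where "x = quat_pair z w"
proof
  show "x = quat_pair (Complex (qa x) (qb x)) (Complex (qc x) (qd x))"
    by (simp add: quat_pair_def)
qed

lemma quat_pair_mult:
  "quat_pair z w * quat_pair z' w' = quat_pair (z * z' - w * cnj w') (z * w' + w * cnj z')"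
  by (simp add: quat_pair_def times_quat_def algebra_simps)

lemma quat_pair_diff: "quat_pair z w - quat_pair z' w' = quat_pair (z - z') (w - w')"
  by (simp add: quat_pair_def minus_quat_def)

lemma quat_cnj_pair: "quat_cnj (quat_pair z w) = quat_pair (cnj z) (- w)"
  by (simp add: quat_pair_def quat_cnj_def)

lemma quat_pair_1: "quat_pair 1 0 = 1"
  by (simp add: quat_pair_def one_quat_def)

lemma complex_upper_cases:
  assumes "t \<in> complex_upper"
  obtains z where "t = quat_pair z 0" "Im z \<ge> 0"
proof -
  from assms obtain a b where "t = of_real a + of_real b * quat_i" "b \<ge> 0"
    unfolding complex_upper_def by blast
  then have "t = quat_pair (Complex a b) 0" "Im (Complex a b) \<ge> 0"
    using Quat_eq [of a b 0 0] by (simp_all add: quat_pair_def)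
  then show thesis
    by (rule that)
qed

section \<open>Two-by-two quaternion matrices\<close>

lemma vector_2_2_eq_iff:
  "(A :: 'a::zero ^ 2 ^ 2) = B \<longleftrightarrow>
    A $ 1 $ 1 = B $ 1 $ 1 \<and> A $ 1 $ 2 = B $ 1 $ 2 \<and> A $ 2 $ 1 = B $ 2 $ 1 \<and> A $ 2 $ 2 = B $ 2 $ 2"
  by (auto simp: vec_eq_iff forall_2)

lemma conj_transpose_mat_1: "conj_transpose (mat 1 :: quat ^ 'n ^ 'n) = mat 1"
  by (simp add: conj_transpose_def mat_def vec_eq_iff)

text \<open>Checking the intertwining relation avoids the triple product; unitarity then moves \<open>Q\<close> over.\<close>

lemma unitary_similarity_if_intertwines:
  assumes "unitary_quat Q" and "T ** Q = Q ** S"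
  shows "conj_transpose Q ** T ** Q = S"
  using assms
  by (metis matrix_mul_assoc matrix_mul_lid unitary_quat_def)

text \<open>
  The columns of \<open>Q\<close> are the eigenvector \<open>(x, 1)\<close> and its orthogonal companion
  \<open>(1, - cnj x)\<close>, both of squared length \<open>1 + x * cnj x\<close>, rotated from the right by \<open>u\<close> and \<open>v\<close>.
\<close>

lemma swap_by_rotated_eigenvector:
  fixes a b c x u v :: quat
  assumes c: "c = x * b - a * x"
    and u: "quat_cnj u * u = 1" "u * b = b * u"
    and v: "quat_cnj v * v = 1" "v * a = a * v"
    and corner: "u * c = (quat_cnj x * a - b * quat_cnj x) * v"
  shows "\<exists>Q :: quat ^ 2 ^ 2. unitary_quat Q \<and>
    conj_transpose Q ** vector [vector [a, c], vector [0, b]] ** Q =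
      vector [vector [b, c], vector [0, a]]"
proof -
  obtain N where N: "N \<ge> 0" "x * quat_cnj x = of_real N" "quat_cnj x * x = of_real N"
    by (rule quat_cnj_mult_self)
  define r where "r = 1 / sqrt (1 + N)"
  have r: "r * r * (1 + N) = 1"
    using N(1) by (simp add: r_def)
  have r': "(r * r) *\<^sub>R (1 + of_real N) = (1 :: quat)"
    using r by (metis of_real_1 of_real_add of_real_mult scaleR_conv_of_real)
  define Q :: "quat ^ 2 ^ 2" where
    "Q = vector [vector [r *\<^sub>R (x * u), r *\<^sub>R v], vector [r *\<^sub>R u, r *\<^sub>R (- (quat_cnj x * v))]]"
  have Q: "Q $ 1 $ 1 = r *\<^sub>R (x * u)" "Q $ 1 $ 2 = r *\<^sub>R v"
    "Q $ 2 $ 1 = r *\<^sub>R u" "Q $ 2 $ 2 = r *\<^sub>R (- (quat_cnj x * v))"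
    by (simp_all add: Q_def)
  have length1: "quat_cnj u * quat_cnj x * (x * u) + quat_cnj u * u = 1 + of_real N"
  proof -
    have "quat_cnj u * quat_cnj x * (x * u) = quat_cnj u * (quat_cnj x * x) * u"
      by (simp add: mult.assoc)
    also have "\<dots> = of_real N * (quat_cnj u * u)"
      by (simp add: N(3) scaleR_conv_of_real [symmetric] of_real_def)
    finally show ?thesis
      by (simp add: u)
  qed
  have length2: "quat_cnj v * v + quat_cnj v * x * (quat_cnj x * v) = 1 + of_real N"
  proof -
    have "quat_cnj v * x * (quat_cnj x * v) = quat_cnj v * (x * quat_cnj x) * v"
      by (simp add: mult.assoc)
    also have "\<dots> = of_real N * (quat_cnj v * v)"
      by (simp add: N(2) scaleR_conv_of_real [symmetric] of_real_def)
    finally show ?thesis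
      by (simp add: v)
  qed
  have "unitary_quat Q"
    unfolding unitary_quat_def vector_2_2_eq_iff
    using r' length1 length2
    by (simp add: matrix_matrix_mult_def sum_2 conj_transpose_def mat_def Q quat_cnj_scaleR
        quat_cnj_mult quat_cnj_minus mult.assoc flip: scaleR_add_right scaleR_diff_right)
  moreover have "vector [vector [a, c], vector [0, b]] ** Q = Q ** vector [vector [b, c], vector [0, a]]"
  proof -
    have e11: "a * (x * u) + c * u = x * u * b"
      by (simp add: c u(2) algebra_simps)
    have central: "x * (quat_cnj x * (a * v)) = a * (x * (quat_cnj x * v))"
      by (simp add: of_real_def N(2) mult.assoc [of x "quat_cnj x", symmetric])
    have e12: "a * v - c * (quat_cnj x * v) = x * u * c + v * a"
    proof -
      have "x * u * c = x * ((quat_cnj x * a - b * quat_cnj x) * v)"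
        by (simp add: mult.assoc corner)
      then show ?thesis
        by (simp add: c v(2) central algebra_simps)
    qed
    have e22: "- (b * (quat_cnj x * v)) = u * c - quat_cnj x * v * a"
      by (simp add: corner v(2) algebra_simps)
    show ?thesis
      unfolding vector_2_2_eq_iff
      using e11 e12 e22 u(2)
      by (simp add: matrix_matrix_mult_def sum_2 Q flip: scaleR_add_right scaleR_diff_right
          scaleR_minus_right)
  qed
  ultimately show ?thesis
    using unitary_similarity_if_intertwines by blast
qed

section \<open>Solving for the eigenvector and the phases\<close>

lemma upper_half_plane_conj_neq:
  assumes "Im \<alpha> \<ge> 0" "Im \<beta> \<ge> 0" "\<alpha> \<noteq> \<beta>"
  shows "cnj \<beta> \<noteq> \<alpha>"
  using assms by (auto simp: complex_eq_iff)

lemma sylvester_solution: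
  assumes "\<alpha> \<noteq> \<beta>" "cnj \<beta> \<noteq> \<alpha>"
  obtains x where "c = x * quat_pair \<beta> 0 - quat_pair \<alpha> 0 * x"
proof -
  obtain z w where c: "c = quat_pair z w"
    by (rule quat_pair_cases)
  have solve: "s = s / (\<gamma> - \<alpha>) * \<gamma> - \<alpha> * (s / (\<gamma> - \<alpha>))" if "\<gamma> \<noteq> \<alpha>" for s \<gamma>
  proof -
    have "s / (\<gamma> - \<alpha>) * \<gamma> - \<alpha> * (s / (\<gamma> - \<alpha>)) = s / (\<gamma> - \<alpha>) * (\<gamma> - \<alpha>)"
      by (simp only: left_diff_distrib right_diff_distrib mult.commute)
    then show ?thesis
      using that by simp
  qed
  have "c = quat_pair (z / (\<beta> - \<alpha>)) (w / (cnj \<beta> - \<alpha>)) * quat_pair \<beta> 0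
      - quat_pair \<alpha> 0 * quat_pair (z / (\<beta> - \<alpha>)) (w / (cnj \<beta> - \<alpha>))"
    using solve [of \<beta> z] solve [of "cnj \<beta>" w] assms
    by (simp add: c quat_pair_mult quat_pair_diff)
  then show thesis
    by (rule that)
qed

lemma unit_ratio:
  assumes "norm z = norm w"
  obtains p :: complex where "norm p = 1" "z = p * w"
proof (cases "w = 0")
  case True
  then show thesis
    using assms that [of 1] by simp
next
  case False
  then show thesis
    using assms that [of "z / w"] by (simp add: norm_divide)
qed

text \<open>
  The two equations force \<open>(cnj u)\<^sup>2 = p * q\<close>, so \<open>cnj u\<close> is taken to be a square root of
  \<open>p * q\<close>, and then \<open>v = u * p\<close>.
\<close>

lemma phases_with_given_products:
  fixes p q :: complex
  assumes "norm p = 1" "norm q = 1"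
  obtains u v where "norm u = 1" "norm v = 1" "cnj u * v = p" "cnj u * cnj v = q"
proof
  define s where "s = csqrt (p * q)"
  have s2: "s * s = p * q"
    by (simp add: s_def flip: power2_eq_square)
  have ns: "norm s = 1"
    by (simp add: s_def norm_csqrt norm_mult assms)
  have unit: "s * cnj s = 1" "p * cnj p = 1"
    using ns assms by (simp_all add: complex_norm_square [symmetric])
  show "norm (cnj s) = 1" "norm (cnj s * p) = 1"
    by (simp_all add: ns norm_mult assms)
  show "cnj (cnj s) * (cnj s * p) = p"
    using unit by (simp flip: mult.assoc)
  have "cnj (cnj s) * cnj (cnj s * p) = (s * s) * cnj p"
    by (simp add: mult.assoc)
  also have "\<dots> = q * (p * cnj p)"
    by (simp add: s2 ac_simps)
  finally show "cnj (cnj s) * cnj (cnj s * p) = q"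
    by (simp add: unit)
qed

text \<open>
  With \<open>x = z + w j\<close>, the complex coordinates of \<open>c\<close> are \<open>z (\<beta> - \<alpha>)\<close> and \<open>w (cnj \<beta> - \<alpha>)\<close>,
  those of the corner are \<open>- cnj z (\<beta> - \<alpha>)\<close> and \<open>w (\<beta> - cnj \<alpha>)\<close>. They agree in modulus, and
  rotating by \<open>cnj u\<close> on the left and \<open>v\<close> on the right multiplies the first coordinate by
  \<open>cnj u * v\<close> and the second by \<open>cnj u * cnj v\<close>.
\<close>

lemma corner_phases:
  obtains u v where "norm u = 1" "norm v = 1"
    "quat_pair u 0 * (x * quat_pair \<beta> 0 - quat_pair \<alpha> 0 * x) =
      (quat_cnj x * quat_pair \<alpha> 0 - quat_pair \<beta> 0 * quat_cnj x) * quat_pair v 0"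
proof -
  obtain z w where x: "x = quat_pair z w"
    by (rule quat_pair_cases)
  obtain p where p: "norm p = 1" "z = p * - cnj z"
    by (rule unit_ratio [of z "- cnj z"]) auto
  have "norm (cnj \<beta> - \<alpha>) = norm (\<beta> - cnj \<alpha>)"
    by (metis complex_cnj_cnj complex_cnj_diff complex_mod_cnj)
  then obtain q where q: "norm q = 1" "cnj \<beta> - \<alpha> = q * (\<beta> - cnj \<alpha>)"
    by (rule unit_ratio)
  obtain u v where uv: "norm u = 1" "norm v = 1" "cnj u * v = p" "cnj u * cnj v = q"
    using phases_with_given_products p(1) q(1) by blast
  have "u * cnj u = 1"
    using uv(1) by (simp add: complex_norm_square [symmetric])
  then have v: "u * p = v" "u * q = cnj v"
    by (simp_all add: uv(3,4) [symmetric] flip: mult.assoc)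
  have "u * z = - (v * cnj z)"
    using p(2) v(1) by (metis mult.assoc mult_minus_right)
  then have "u * (z * (\<beta> - \<alpha>)) = - (v * cnj z) * (\<beta> - \<alpha>)"
    by (metis mult.assoc)
  then have first: "u * (z * (\<beta> - \<alpha>)) = (cnj z * \<alpha> - \<beta> * cnj z) * v"
    by (simp add: algebra_simps)
  have "u * (cnj \<beta> - \<alpha>) = cnj v * (\<beta> - cnj \<alpha>)"
    by (simp add: q(2) v(2) flip: mult.assoc)
  then have "u * (w * (cnj \<beta> - \<alpha>)) = w * (cnj v * (\<beta> - cnj \<alpha>))"
    by (metis mult.left_commute)
  then have second: "u * (w * (cnj \<beta> - \<alpha>)) = (\<beta> * w - w * cnj \<alpha>) * cnj v"
    by (simp add: algebra_simps)
  have "quat_pair u 0 * (x * quat_pair \<beta> 0 - quat_pair \<alpha> 0 * x) =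
      quat_pair (u * (z * (\<beta> - \<alpha>))) (u * (w * (cnj \<beta> - \<alpha>)))"
    by (simp add: x quat_pair_mult quat_pair_diff algebra_simps)
  also have "\<dots> = (quat_cnj x * quat_pair \<alpha> 0 - quat_pair \<beta> 0 * quat_cnj x) * quat_pair v 0"
    unfolding first second
    by (simp add: x quat_cnj_pair quat_pair_mult quat_pair_diff algebra_simps)
  finally show thesis
    using that uv by blast
qed

section \<open>Swapping the diagonal entries\<close>

theorem theorem1:
  fixes t11 t12 t22 :: quat and T :: "quat ^ 2 ^ 2"
  assumes "t11 \<in> complex_upper" and "t22 \<in> complex_upper"
    and "T = vector [vector [t11, t12], vector [0, t22]]"
  shows "\<exists>Q :: quat ^ 2 ^ 2. unitary_quat Q \<and>
    conj_transpose Q ** T ** Q = vector [vector [t22, t12], vector [0, t11]]"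
proof (cases "t11 = t22")
  case True
  then have "unitary_quat (mat 1 :: quat ^ 2 ^ 2)"
    "conj_transpose (mat 1) ** T ** mat 1 = vector [vector [t22, t12], vector [0, t11]]"
    by (simp_all add: assms(3) unitary_quat_def conj_transpose_mat_1)
  then show ?thesis
    by blast
next
  case False
  obtain \<alpha> where \<alpha>: "t11 = quat_pair \<alpha> 0" "Im \<alpha> \<ge> 0"
    using assms(1) by (rule complex_upper_cases)
  obtain \<beta> where \<beta>: "t22 = quat_pair \<beta> 0" "Im \<beta> \<ge> 0"
    using assms(2) by (rule complex_upper_cases)
  have "\<alpha> \<noteq> \<beta>"
    using False \<alpha>(1) \<beta>(1) by blast
  moreover from this have "cnj \<beta> \<noteq> \<alpha>"
    using \<alpha>(2) \<beta>(2) upper_half_plane_conj_neq by blast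
  ultimately obtain x where x: "t12 = x * t22 - t11 * x"
    using sylvester_solution \<alpha>(1) \<beta>(1) by blast
  obtain u v where uv: "norm u = 1" "norm v = 1"
    and corner: "quat_pair u 0 * t12 = (quat_cnj x * t11 - t22 * quat_cnj x) * quat_pair v 0"
    using corner_phases x unfolding \<alpha>(1) \<beta>(1) by metis
  have unit: "quat_cnj (quat_pair s 0) * quat_pair s 0 = 1" if "norm s = 1" for s
    using that
    by (simp add: quat_cnj_pair quat_pair_mult quat_pair_1 mult.commute [of "cnj s"]
        complex_norm_square [symmetric])
  have comm: "quat_pair s 0 * quat_pair z 0 = quat_pair z 0 * quat_pair s 0" for s z
    by (simp add: quat_pair_mult mult.commute)
  show ?thesis
    unfolding assms(3)
    by (rule swap_by_rotated_eigenvector [OF x unit _ unit _ corner])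
      (simp_all add: uv comm \<alpha>(1) \<beta>(1))
qed

end
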